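(* For every Coxeter system $(W,S)$, the formal power series $W^{FC}(t)=\sum_{l\geq 0}|W^{FC}_l|\,t^l$ is a rational function of $t$. Equivalently, the sequence $(|W^{FC}_l|)_{l\ge 0}$ satisfies a linear recurrence with constant coefficients for all sufficiently large $l$.
   Context: A Coxeter system $(W,S)$ consists of a finite set $S$ and a symmetric matrix $(m_{st})_{s,t\in S}$ with $m_{ss}=1$ and $m_{st}\in\{2,3,\dots\}\cup\{\infty\}$ for $s\neq t$; $W$ is the group generated by $S$ subject to $(st)^{m_{st}}=1$ whenever $m_{st}<\infty$. The length $\ell(w)$ of $w\in W$ is the smallest $l$ such that $w=s_1\cdots s_l$ with $s_i\in S$; such words of length $\ell(w)$ are the reduced expressions of $w$, forming the set $\mathcal R(w)\subseteq S^*$. Two words in $S^*$ are commutation equivalent if one can pass from one to the other by repeatedly replacing a factor $st$ by $ts$ where $m_{st}=2$. An element $w\in W$ is fully commutative (FC) if $\mathcal R(w)$ is a single commutation equivalence class. $W^{FC}$ denotes the set of FC elements and $W^{FC}_l$ the set of FC elements of length $l$. *)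

theory Defs
  imports "HOL-Library.Extended_Nat" "HOL-Computational_Algebra.Formal_Power_Series"
          "HOL-Computational_Algebra.Polynomial_FPS"
begin

definition coxeter_matrix :: "'a set \<Rightarrow> ('a \<Rightarrow> 'a \<Rightarrow> enat) \<Rightarrow> bool" where
  "coxeter_matrix S m \<longleftrightarrow> finite S \<and>
     (\<forall>s\<in>S. \<forall>t\<in>S. m s t = m t s) \<and>
     (\<forall>s\<in>S. m s s = 1) \<and>
     (\<forall>s\<in>S. \<forall>t\<in>S. s \<noteq> t \<longrightarrow> m s t \<ge> 2)"

text \<open>One-step relation of the presentation: delete a factor (st)^(m_st) when m_st is finite.
  Its equivalence closure is the congruence on S^* defining W (the monoid presented by
  these relations is the group W since each s is an involution).\<close>
inductive cox_step :: "'a set \<Rightarrow> ('a \<Rightarrow> 'a \<Rightarrow> enat) \<Rightarrow> 'a list \<Rightarrow> 'a list \<Rightarrow> bool"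
  for S m where
  "s \<in> S \<Longrightarrow> t \<in> S \<Longrightarrow> m s t = enat k \<Longrightarrow>
     cox_step S m (u @ concat (replicate k [s, t]) @ v) (u @ v)"

definition cox_eq :: "'a set \<Rightarrow> ('a \<Rightarrow> 'a \<Rightarrow> enat) \<Rightarrow> 'a list \<Rightarrow> 'a list \<Rightarrow> bool" where
  "cox_eq S m = equivclp (cox_step S m)"

definition cox_elem :: "'a set \<Rightarrow> ('a \<Rightarrow> 'a \<Rightarrow> enat) \<Rightarrow> 'a list \<Rightarrow> 'a list set" where
  "cox_elem S m u = {v \<in> lists S. cox_eq S m v u}"

definition cox_length :: "'a set \<Rightarrow> ('a \<Rightarrow> 'a \<Rightarrow> enat) \<Rightarrow> 'a list \<Rightarrow> nat" where
  "cox_length S m u = (LEAST n. \<exists>v \<in> cox_elem S m u. length v = n)"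

definition reduced_exprs :: "'a set \<Rightarrow> ('a \<Rightarrow> 'a \<Rightarrow> enat) \<Rightarrow> 'a list \<Rightarrow> 'a list set" where
  "reduced_exprs S m u = {v \<in> cox_elem S m u. length v = cox_length S m u}"

inductive comm_step :: "'a set \<Rightarrow> ('a \<Rightarrow> 'a \<Rightarrow> enat) \<Rightarrow> 'a list \<Rightarrow> 'a list \<Rightarrow> bool"
  for S m where
  "s \<in> S \<Longrightarrow> t \<in> S \<Longrightarrow> m s t = 2 \<Longrightarrow>
     comm_step S m (u @ [s, t] @ v) (u @ [t, s] @ v)"

definition comm_eq :: "'a set \<Rightarrow> ('a \<Rightarrow> 'a \<Rightarrow> enat) \<Rightarrow> 'a list \<Rightarrow> 'a list \<Rightarrow> bool" where
  "comm_eq S m = equivclp (comm_step S m)"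

definition fully_commutative :: "'a set \<Rightarrow> ('a \<Rightarrow> 'a \<Rightarrow> enat) \<Rightarrow> 'a list \<Rightarrow> bool" where
  "fully_commutative S m u \<longleftrightarrow>
     (\<forall>v \<in> reduced_exprs S m u. \<forall>w \<in> reduced_exprs S m u. comm_eq S m v w)"

definition FC_elems :: "'a set \<Rightarrow> ('a \<Rightarrow> 'a \<Rightarrow> enat) \<Rightarrow> nat \<Rightarrow> 'a list set set" where
  "FC_elems S m l = {cox_elem S m u | u. u \<in> lists S \<and> cox_length S m u = l
                                         \<and> fully_commutative S m u}"

end

theory Submission
  imports Defs
begin

text \<open>
  By the solution of the word problem, a word is a reduced expression of a fully commutative
  element iff no word in its commutation class contains a factor \<open>ss\<close> or a braid word
  \<open>sts\<dots>\<close> of length \<open>m s t \<ge> 3\<close>; fully commutative elements thus correspond to the commutation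
  classes of such words. The word problem is solved by Mozes' numbers game: positions are real
  functions on \<open>S\<close>, started at the constant 1, and reduced words are exactly those in which every
  letter is fired at a positive value. Which bad factors (or prefixes of them) can be moved to the
  end of a word, up to letters from a prescribed set, is a finite amount of data that is updated
  letter by letter. Together with a canonical choice of a last letter of each class this gives a
  transfer matrix for the numbers of classes, hence a rational generating function.
\<close>

unbundle fps_syntax

subsection \<open>Rational power series\<close>

text \<open>The condition on \<open>coeff q 0\<close> makes \<open>q\<close> a unit among the power
  series, so \<open>F\<close> is the expansion of \<open>p / q\<close> at 0.\<close>

definition rational_fps :: "'b::field fps \<Rightarrow> bool" where
  "rational_fps F \<longleftrightarrow> (\<exists>p q. coeff q 0 \<noteq> 0 \<and> F * fps_of_poly q = fps_of_poly p)"

lemma rational_fps_poly: "rational_fps (fps_of_poly p)"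
  unfolding rational_fps_def by (rule exI[of _ p], rule exI[of _ 1]) simp

lemma rational_fps_const: "rational_fps (fps_const c)"
  using rational_fps_poly[of "[:c:]"] by (simp add: fps_of_poly_const)

lemma rational_fps_const_X: "rational_fps (fps_const c * fps_X)"
  using rational_fps_poly[of "[:0, c:]"] by (simp add: fps_of_poly_pCons fps_of_poly_const)

lemma rational_fps_add:
  assumes "rational_fps F" "rational_fps G"
  shows "rational_fps (F + G)"
proof -
  from assms obtain p q p' q' where
    "coeff q 0 \<noteq> 0" "F * fps_of_poly q = fps_of_poly p"
    "coeff q' 0 \<noteq> 0" "G * fps_of_poly q' = fps_of_poly p'"
    unfolding rational_fps_def by blast
  moreover have "(F + G) * (fps_of_poly q * fps_of_poly q')
      = (F * fps_of_poly q) * fps_of_poly q' + (G * fps_of_poly q') * fps_of_poly q"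
    by (simp add: algebra_simps)
  ultimately show ?thesis
    unfolding rational_fps_def
    by (intro exI[of _ "p * q' + p' * q"] exI[of _ "q * q'"])
       (simp add: coeff_mult fps_of_poly_add fps_of_poly_mult)
qed

lemma rational_fps_mult:
  assumes "rational_fps F" "rational_fps G"
  shows "rational_fps (F * G)"
proof -
  from assms obtain p q p' q' where
    "coeff q 0 \<noteq> 0" "F * fps_of_poly q = fps_of_poly p"
    "coeff q' 0 \<noteq> 0" "G * fps_of_poly q' = fps_of_poly p'"
    unfolding rational_fps_def by blast
  moreover have "(F * G) * (fps_of_poly q * fps_of_poly q')
      = (F * fps_of_poly q) * (G * fps_of_poly q')"
    by (simp add: algebra_simps)
  ultimately show ?thesis
    unfolding rational_fps_def
    by (intro exI[of _ "p * p'"] exI[of _ "q * q'"]) (simp add: coeff_mult fps_of_poly_mult)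
qed

lemma rational_fps_sum: "(\<And>i. i \<in> I \<Longrightarrow> rational_fps (F i)) \<Longrightarrow> rational_fps (\<Sum>i\<in>I. F i)"
  by (induction I rule: infinite_finite_induct)
     (use rational_fps_const[of 0] in \<open>auto intro: rational_fps_add\<close>)

lemma rational_fps_diff:
  assumes "rational_fps F" "rational_fps G"
  shows "rational_fps (F - G)"
  using rational_fps_add[OF assms(1) rational_fps_mult[OF rational_fps_const[of "-1"] assms(2)]]
  by (simp flip: fps_const_neg)

text \<open>Numerator and denominator change places; the new denominator \<open>p\<close> has
  constant term \<open>F $ 0 * coeff q 0\<close>, which is nonzero.\<close>

lemma rational_fps_inverse:
  assumes "rational_fps F" "F $ 0 \<noteq> 0"
  shows "rational_fps (inverse F)"
proof -
  from assms obtain p q where pq: "coeff q 0 \<noteq> 0" "F * fps_of_poly q = fps_of_poly p"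
    unfolding rational_fps_def by blast
  have "coeff p 0 = F $ 0 * coeff q 0"
    using pq(2) by (metis fps_mult_nth_0 fps_of_poly_nth)
  moreover have "inverse F * fps_of_poly p = fps_of_poly q"
    using inverse_mult_eq_1[OF assms(2)] by (simp flip: pq(2) mult.assoc)
  ultimately show ?thesis
    using pq(1) assms(2) unfolding rational_fps_def
    by (intro exI[of _ q] exI[of _ p]) simp
qed

text \<open>Gaussian elimination: the pivots \<open>1 - A k k\<close> have constant term 1, hence are invertible.\<close>

lemma rational_fps_linear_system:
  fixes F P :: "'i \<Rightarrow> 'b::field fps" and A :: "'i \<Rightarrow> 'i \<Rightarrow> 'b fps"
  assumes "finite I"
    and "\<And>i. i \<in> I \<Longrightarrow> rational_fps (P i)"
    and "\<And>i j. i \<in> I \<Longrightarrow> j \<in> I \<Longrightarrow> rational_fps (A i j)"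
    and "\<And>i j. i \<in> I \<Longrightarrow> j \<in> I \<Longrightarrow> A i j $ 0 = 0"
    and "\<And>i. i \<in> I \<Longrightarrow> F i = P i + (\<Sum>j\<in>I. A i j * F j)"
    and "i \<in> I"
  shows "rational_fps (F i)"
  using assms
proof (induction I arbitrary: P A i rule: finite_induct)
  case empty
  then show ?case by simp
next
  case (insert k I)
  note P = insert.prems(1) and A = insert.prems(2) and A0 = insert.prems(3)
    and F = insert.prems(4)
  define c where "c = inverse (1 - A k k)"
  have unit: "(1 - A k k) $ 0 \<noteq> 0" using A0[of k k] by simp
  have c: "rational_fps c"
    unfolding c_def using rational_fps_const[of 1] A[of k k] unit
    by (intro rational_fps_inverse rational_fps_diff) auto
  have "(1 - A k k) * F k = P k + (\<Sum>j\<in>I. A k j * F j)"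
    using F[of k] insert.hyps by (simp add: algebra_simps)
  then have "c * ((1 - A k k) * F k) = c * (P k + (\<Sum>j\<in>I. A k j * F j))" by simp
  then have Fk: "F k = c * (P k + (\<Sum>j\<in>I. A k j * F j))"
    using inverse_mult_eq_1[OF unit] by (simp add: c_def flip: mult.assoc)
  \<comment> \<open>Substituting the solved equation for \<open>F k\<close> leaves a system of the
    same shape over the smaller index set, whose coefficients again have constant term 0.\<close>
  have F': "F i = (P i + A i k * c * P k) + (\<Sum>j\<in>I. (A i j + A i k * c * A k j) * F j)"
    if "i \<in> I" for i
  proof -
    have "F i = P i + A i k * F k + (\<Sum>j\<in>I. A i j * F j)"
      using F[of i] that insert.hyps by simp
    also have "A i k * F k = A i k * c * P k + (\<Sum>j\<in>I. A i k * c * A k j * F j)"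
      by (subst Fk) (simp add: algebra_simps sum_distrib_left)
    finally show ?thesis by (simp add: algebra_simps sum.distrib)
  qed
  have R: "rational_fps (F i)" if "i \<in> I" for i
  proof (rule insert.IH[where P = "\<lambda>i. P i + A i k * c * P k"
        and A = "\<lambda>i j. A i j + A i k * c * A k j", OF _ _ _ _ that])
    show "rational_fps (P i + A i k * c * P k)" if "i \<in> I" for i
      using that P A c by (intro rational_fps_add rational_fps_mult) auto
    show "rational_fps (A i j + A i k * c * A k j)" if "i \<in> I" "j \<in> I" for i j
      using that A c by (intro rational_fps_add rational_fps_mult) auto
    show "(A i j + A i k * c * A k j) $ 0 = 0" if "i \<in> I" "j \<in> I" for i j
      using that A0 by simp
    show "F i = (P i + A i k * c * P k) + (\<Sum>j\<in>I. (A i j + A i k * c * A k j) * F j)"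
      if "i \<in> I" for i by (rule F'[OF that])
  qed
  have "rational_fps (F k)"
    by (subst Fk) (use P A R c in \<open>auto intro!: rational_fps_add rational_fps_mult rational_fps_sum\<close>)
  with R insert.prems(5) show ?case by auto
qed

text \<open>The recursion says that the vector of generating functions satisfies
  \<open>F = n 0 + X M F\<close>; the factor \<open>X\<close> supplies the zero constant terms that
  elimination requires.\<close>

lemma rational_fps_transfer_matrix:
  fixes n :: "nat \<Rightarrow> 'q \<Rightarrow> 'b::field" and M :: "'q \<Rightarrow> 'q \<Rightarrow> 'b"
  assumes "finite Q"
    and rec: "\<And>l q. q \<in> Q \<Longrightarrow> n (Suc l) q = (\<Sum>q'\<in>Q. M q q' * n l q')"
  shows "rational_fps (Abs_fps (\<lambda>l. \<Sum>q\<in>Q. n l q))"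
proof -
  define F where "F q = Abs_fps (\<lambda>l. n l q)" for q
  have "F q = fps_const (n 0 q) + (\<Sum>q'\<in>Q. (fps_const (M q q') * fps_X) * F q')"
    if "q \<in> Q" for q
  proof (rule fps_ext)
    fix l
    show "F q $ l = (fps_const (n 0 q) + (\<Sum>q'\<in>Q. (fps_const (M q q') * fps_X) * F q')) $ l"
      by (cases l) (use rec[OF that] in \<open>simp_all add: F_def fps_sum_nth mult.assoc\<close>)
  qed
  then have "rational_fps (F q)" if "q \<in> Q" for q
    by (rule rational_fps_linear_system[OF assms(1), rotated -2, OF _ that])
       (simp_all add: rational_fps_const rational_fps_const_X)
  moreover have "Abs_fps (\<lambda>l. \<Sum>q\<in>Q. n l q) = (\<Sum>q\<in>Q. F q)"
    by (rule fps_ext) (simp add: F_def fps_sum_nth)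
  ultimately show ?thesis by (simp add: rational_fps_sum)
qed

subsection \<open>Words\<close>

fun alt_word :: "nat \<Rightarrow> 'a \<Rightarrow> 'a \<Rightarrow> 'a list" where
  "alt_word 0 s t = []"
| "alt_word (Suc n) s t = s # alt_word n t s"

lemma length_alt_word [simp]: "length (alt_word n s t) = n"
  by (induction n arbitrary: s t) auto

lemma set_alt_word_subset: "set (alt_word n s t) \<subseteq> {s, t}"
  by (induction n arbitrary: s t) auto

lemma alt_word_in_lists: "s \<in> A \<Longrightarrow> t \<in> A \<Longrightarrow> alt_word n s t \<in> lists A"
  using set_alt_word_subset[of n s t] by auto

lemma alt_word_add:
  "alt_word (k + n) s t
     = alt_word k s t @ (if even k then alt_word n s t else alt_word n t s)"
  by (induction k arbitrary: s t) auto

lemma alt_word_snoc: "alt_word (Suc n) s t = alt_word n s t @ [if even n then s else t]"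
  using alt_word_add[of n 1 s t] by (cases "even n") simp_all

lemma rev_alt_word: "rev (alt_word n s t) = (if even n then alt_word n t s else alt_word n s t)"
proof (induction n arbitrary: s t)
  case (Suc n)
  show ?case by (subst alt_word_snoc) (simp add: Suc)
qed simp

lemma alt_word_double: "alt_word (2 * k) s t = alt_word k s t @ rev (alt_word k t s)"
  using alt_word_add[of k k s t] by (simp add: rev_alt_word mult_2)

lemma concat_replicate_pair: "concat (replicate k [s, t]) = alt_word (2 * k) s t"
  by (induction k) auto

lemma equivclp_append_context:
  assumes "\<And>x y. R x y \<Longrightarrow> R (u @ x @ v) (u @ y @ v)" and "equivclp R x y"
  shows "equivclp R (u @ x @ v) (u @ y @ v)"
  using assms(2)
proof (induction rule: equivclp_induct)
  case (step y z)
  then show ?case using assms(1) equivclp_into_equivclp by metis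
qed simp

text \<open>Locates a marked letter \<open>r\<close> relative to the two letters exchanged by a
  commutation step: to their right, the second, the first, or to their left.\<close>

lemma append_Cons_eq_append_pair_cases:
  assumes "y1 @ r # y2 = u @ s # t # v"
  obtains v' where "y1 = u @ s # t # v'" "v = v' @ r # y2"
  | "y1 = u @ [s]" "r = t" "v = y2"
  | "y1 = u" "r = s" "y2 = t # v"
  | u' where "u = y1 @ r # u'" "y2 = u' @ s # t # v"
  using assms
  by (auto simp: append_eq_append_conv2 append_eq_Cons_conv Cons_eq_append_conv)

lemma append_Cons_eq_append3_cases:
  assumes "y1 @ r # y2 = u @ x @ v"
  obtains u' where "u = y1 @ r # u'" "y2 = u' @ x @ v"
  | x1 x2 where "x = x1 @ r # x2" "y1 = u @ x1" "y2 = x2 @ v"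
  | v' where "v = v' @ r # y2" "y1 = u @ x @ v'"
  using assms
  by (auto simp: append_eq_append_conv2 append_eq_Cons_conv Cons_eq_append_conv)

text \<open>Both images are models of the quotient of \<open>A\<close> by the same equivalence
  relation.\<close>

lemma card_image_eq_card_image:
  assumes "\<And>x y. x \<in> A \<Longrightarrow> y \<in> A \<Longrightarrow> f x = f y \<longleftrightarrow> g x = g y"
  shows "card (f ` A) = card (g ` A)"
proof -
  have inv: "inv_into A g (g x) \<in> A" "f (inv_into A g (g x)) = f x" if "x \<in> A" for x
    using that assms[of "inv_into A g (g x)" x] by (auto intro: inv_into_into f_inv_into_f)
  have "bij_betw (f \<circ> inv_into A g) (g ` A) (f ` A)"
    unfolding bij_betw_def
  proof
    show "inj_on (f \<circ> inv_into A g) (g ` A)"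
      using inv assms by (auto intro!: inj_onI)
    show "(f \<circ> inv_into A g) ` g ` A = f ` A"
      using inv by (auto simp: image_iff)
  qed
  then show ?thesis by (simp add: bij_betw_same_card)
qed

subsection \<open>The numbers game\<close>

text \<open>Minus twice the value \<open>- cos (pi / m)\<close> of the standard bilinear form on two
  simple roots, with its limit for \<open>\<infinity>\<close>.\<close>

definition weight :: "enat \<Rightarrow> real" where
  "weight k = (case k of enat j \<Rightarrow> 2 * cos (pi / real j) | \<infinity> \<Rightarrow> 2)"

text \<open>Chebyshev polynomials of the second kind, shifted in the index and evaluated at
  \<open>weight k / 2\<close>; the index is real so that it may take the value \<open>-1\<close>.\<close>

definition cheb :: "enat \<Rightarrow> real \<Rightarrow> real" where
  "cheb k x = (case k of enat j \<Rightarrow> sin (x * pi / real j) / sin (pi / real j) | \<infinity> \<Rightarrow> x)"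

lemma sin_pi_over_pos: "2 \<le> j \<Longrightarrow> 0 < sin (pi / real j)"
  by (intro sin_gt_zero) (auto simp: field_simps)

lemma cheb_rec: "cheb k (x + 1) = weight k * cheb k x - cheb k (x - 1)"
proof (cases k)
  case (enat j)
  have "sin ((x + 1) * pi / j) + sin ((x - 1) * pi / j) = 2 * cos (pi / j) * sin (x * pi / j)"
    by (simp add: ring_distribs add_divide_distrib diff_divide_distrib sin_add sin_diff)
  then show ?thesis by (simp add: enat cheb_def weight_def add_divide_distrib[symmetric]
        diff_divide_distrib[symmetric] eq_diff_eq)
qed (simp add: cheb_def weight_def)

lemma cheb_0 [simp]: "cheb k 0 = 0"
  by (cases k) (auto simp: cheb_def)

lemma cheb_1 [simp]: "2 \<le> k \<Longrightarrow> cheb k 1 = 1"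
  using sin_pi_over_pos by (cases k) (force simp: cheb_def numeral_eq_enat)+

lemma cheb_minus_1 [simp]: "2 \<le> k \<Longrightarrow> cheb k (- 1) = - 1"
  using sin_pi_over_pos by (cases k) (force simp: cheb_def numeral_eq_enat)+

lemma cheb_pos:
  assumes "2 \<le> k" "0 < n" "enat n < k"
  shows "0 < cheb k (real n)"
proof (cases k)
  case (enat j)
  with assms have j: "2 \<le> j" "n < j" by (auto simp: numeral_eq_enat)
  then have "real n * pi / j < pi" by (simp add: field_simps)
  moreover have "0 < real n * pi / j" using assms(2) j by simp
  ultimately have "0 < sin (real n * pi / j)" by (intro sin_gt_zero)
  with sin_pi_over_pos[OF j(1)] show ?thesis by (simp add: cheb_def enat)
qed (use assms in \<open>simp add: cheb_def\<close>)

lemma cheb_order: "2 \<le> j \<Longrightarrow> cheb (enat j) (real j) = 0"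
  by (simp add: cheb_def)

lemma cheb_nonneg: "2 \<le> k \<Longrightarrow> enat n \<le> k \<Longrightarrow> 0 \<le> cheb k (real n)"
  using cheb_pos[of k n] cheb_order[of n]
  by (cases "n = 0"; cases "k = enat n")
    (auto simp: numeral_eq_enat intro: less_imp_le dest: order.not_eq_order_implies_strict[of "enat n" k])

lemma cheb_order_plus:
  assumes "2 \<le> j"
  shows "cheb (enat j) (real j + x) = - cheb (enat j) x"
proof -
  have "(real j + x) * pi / j = x * pi / j + pi" using assms by (simp add: field_simps)
  then show ?thesis by (simp add: cheb_def)
qed

locale coxeter_system =
  fixes S :: "'a set" and m :: "'a \<Rightarrow> 'a \<Rightarrow> enat"
  assumes coxeter: "coxeter_matrix S m"
begin

lemma finite_S: "finite S"
  using coxeter by (simp add: coxeter_matrix_def)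

lemma m_sym: "s \<in> S \<Longrightarrow> t \<in> S \<Longrightarrow> m s t = m t s"
  using coxeter by (simp add: coxeter_matrix_def)

lemma m_self [simp]: "s \<in> S \<Longrightarrow> m s s = 1"
  using coxeter by (simp add: coxeter_matrix_def)

lemma m_ge_2: "s \<in> S \<Longrightarrow> t \<in> S \<Longrightarrow> s \<noteq> t \<Longrightarrow> 2 \<le> m s t"
  using coxeter by (simp add: coxeter_matrix_def)

text \<open>This is the action of \<open>W\<close> dual to its geometric representation, the position \<open>f\<close>
  recording the values of a linear functional on the simple roots.\<close>

definition fire :: "'a \<Rightarrow> ('a \<Rightarrow> real) \<Rightarrow> 'a \<Rightarrow> real" where
  "fire s f r = (if r = s then - f s else f r + weight (m s r) * f s)"

abbreviation play :: "'a list \<Rightarrow> ('a \<Rightarrow> real) \<Rightarrow> 'a \<Rightarrow> real" where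
  "play \<equiv> fold fire"

fun legal :: "('a \<Rightarrow> real) \<Rightarrow> 'a list \<Rightarrow> bool" where
  "legal f [] \<longleftrightarrow> True"
| "legal f (s # w) \<longleftrightarrow> 0 < f s \<and> legal (fire s f) w"

lemma legal_append: "legal f (u @ v) \<longleftrightarrow> legal f u \<and> legal (play u f) v"
  by (induction u arbitrary: f) auto

lemma fire_self [simp]: "fire s f s = - f s"
  by (simp add: fire_def)

lemma fire_fire [simp]: "fire s (fire s f) = f"
  by (rule ext) (simp add: fire_def)

text \<open>Induction removes the first letter and exchanges \<open>s\<close> and \<open>t\<close>;
  \<open>cheb_rec\<close> recombines the coefficients. The first formula is the value at the letter
  that would be fired next, the second at the other letter, which for positive \<open>n\<close> was
  fired last. The index -1 arises in the second at \<open>n = 0\<close>.\<close>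

lemma play_alt_word:
  assumes "s \<in> S" "t \<in> S" "s \<noteq> t"
  shows "play (alt_word n s t) f (if even n then s else t)
           = f s * cheb (m s t) (real n + 1) + f t * cheb (m s t) (real n)"
    and "play (alt_word n s t) f (if even n then t else s)
           = - (f s * cheb (m s t) (real n) + f t * cheb (m s t) (real n - 1))"
  using assms
proof (induction n arbitrary: s t f)
  case 0
  {
    case 1 then show ?case by (simp add: m_ge_2)
  next
    case 2 then show ?case by (simp add: m_ge_2)
  }
next
  case (Suc n)
  {
    case 1
    then have "m t s = m s t" "fire s f t = f t + weight (m s t) * f s"
      by (simp_all add: m_sym fire_def)
    moreover have rec: "cheb (m s t) (real n + 2)
        = weight (m s t) * cheb (m s t) (1 + real n) - cheb (m s t) (real n)"
      using cheb_rec[of "m s t" "real n + 1"] by (simp add: algebra_simps)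
    ultimately show ?case
      using Suc(1)[of t s "fire s f"] 1 by (cases "even n") (simp_all add: rec algebra_simps)
  next
    case 2
    then have "m t s = m s t" "fire s f t = f t + weight (m s t) * f s"
      by (simp_all add: m_sym fire_def)
    moreover have rec: "cheb (m s t) (1 + real n)
        = weight (m s t) * cheb (m s t) (real n) - cheb (m s t) (real n - 1)"
      using cheb_rec[of "m s t" "real n"] by (simp add: algebra_simps)
    ultimately show ?case
      using Suc(2)[of t s "fire s f"] 2 by (cases "even n") (simp_all add: rec algebra_simps)
  }
qed

text \<open>Since the form is nondegenerate on the plane spanned by two simple roots with \<open>m s t\<close>
  finite, every other coordinate can be corrected by a combination of \<open>f s\<close> and \<open>f t\<close> to an
  invariant of the two moves.\<close>

lemma dihedral_invariant:
  assumes st: "s \<in> S" "t \<in> S" "s \<noteq> t" "m s t = enat j" and r: "r \<noteq> s" "r \<noteq> t"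
  obtains \<alpha> \<beta> where
    "\<And>f w. w \<in> lists {s, t} \<Longrightarrow>
       play w f r + \<alpha> * play w f s + \<beta> * play w f t = f r + \<alpha> * f s + \<beta> * f t"
proof -
  define c p q where "c = weight (m s t)" and "p = weight (m s r)" and "q = weight (m t r)"
  \<comment> \<open>Cramer's rule for the system \<open>2 * \<alpha> - c * \<beta> = p\<close>,
    \<open>2 * \<beta> - c * \<alpha> = q\<close>, with determinant 4 - c^2 = 4 sin^2(pi / j),
    nonzero since \<open>j\<close> is finite and at least 2.\<close>
  define \<alpha> \<beta> where "\<alpha> = (2 * p + c * q) / (4 - c\<^sup>2)" and "\<beta> = (2 * q + c * p) / (4 - c\<^sup>2)"
  have "2 \<le> j" using m_ge_2[of s t] st by (simp add: numeral_eq_enat)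
  then have "0 < (sin (pi / j))\<^sup>2" using sin_pi_over_pos by force
  then have "(cos (pi / j))\<^sup>2 < 1" by (simp add: cos_squared_eq)
  then have nz: "4 - c\<^sup>2 \<noteq> 0" by (simp add: c_def st weight_def power_mult_distrib)
  have "2 * \<alpha> - c * \<beta> = p * (4 - c\<^sup>2) / (4 - c\<^sup>2)" "2 * \<beta> - c * \<alpha> = q * (4 - c\<^sup>2) / (4 - c\<^sup>2)"
    unfolding \<alpha>_def \<beta>_def times_divide_eq_right diff_divide_distrib[symmetric]
    by (simp_all add: algebra_simps power2_eq_square)
  with nz have ab: "2 * \<alpha> - c * \<beta> = p" "2 * \<beta> - c * \<alpha> = q" by simp_all
  have cs: "weight (m t s) = c" using st m_sym by (simp add: c_def)
  have "fire x f r + \<alpha> * fire x f s + \<beta> * fire x f t = f r + \<alpha> * f s + \<beta> * f t"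
    if "x = s \<or> x = t" for x f
    using that
  proof
    assume "x = s"
    then have "fire x f r + \<alpha> * fire x f s + \<beta> * fire x f t
      = f r + \<alpha> * f s + \<beta> * f t - (2 * \<alpha> - c * \<beta> - p) * f s"
      using r st(3) by (simp add: fire_def flip: c_def p_def) (simp add: algebra_simps)
    with ab show ?thesis by simp
  next
    assume "x = t"
    then have "fire x f r + \<alpha> * fire x f s + \<beta> * fire x f t
      = f r + \<alpha> * f s + \<beta> * f t - (2 * \<beta> - c * \<alpha> - q) * f t"
      using r st(3) cs by (simp add: fire_def flip: q_def) (simp add: algebra_simps)
    with ab show ?thesis by simp
  qed
  then have "play w f r + \<alpha> * play w f s + \<beta> * play w f t = f r + \<alpha> * f s + \<beta> * f t"
    if "w \<in> lists {s, t}" for f w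
    using that by (induction w arbitrary: f) auto
  then show thesis by (rule that)
qed

text \<open>A shift by \<open>j\<close> moves the sine in \<open>cheb\<close> by pi, so
  \<open>2 * j\<close> is a period and the coordinates \<open>s\<close> and \<open>t\<close> return
  to their values; the dihedral invariant then forces every other coordinate to return.\<close>

lemma play_relator:
  assumes "s \<in> S" "t \<in> S" "m s t = enat j"
  shows "play (alt_word (2 * j) s t) f = f"
proof (cases "s = t")
  case True
  with assms have "j = 1" by (simp add: one_enat_def)
  with True show ?thesis by (simp add: numeral_2_eq_2)
next
  case False
  let ?w = "alt_word (2 * j) s t"
  have j: "2 \<le> j" using m_ge_2[of s t] assms False by (simp add: numeral_eq_enat)
  have "cheb (m s t) (2 * real j + x) = cheb (m s t) x" for x
    by (simp only: mult_2 add.assoc assms(3) cheb_order_plus[OF j] minus_minus)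
  from this[of 0] this[of 1] this[of "-1"]
  have s: "play ?w f s = f s" and t: "play ?w f t = f t"
    using play_alt_word[OF assms(1,2) False, of "2 * j" f] m_ge_2[OF assms(1,2) False]
    by simp_all
  show ?thesis
  proof
    fix r
    show "play ?w f r = f r"
    proof (cases "r = s \<or> r = t")
      case False
      with dihedral_invariant[OF assms(1,2) \<open>s \<noteq> t\<close> assms(3), of r] obtain \<alpha> \<beta> where
        "\<And>f w. w \<in> lists {s, t} \<Longrightarrow>
          play w f r + \<alpha> * play w f s + \<beta> * play w f t = f r + \<alpha> * f s + \<beta> * f t"
        by metis
      from this[of ?w f] show ?thesis
        using s t alt_word_in_lists[of s "{s, t}" t "2 * j"] by simp
    qed (use s t in auto)
  qed
qed

text \<open>Relators act trivially, so the position reached depends only on the group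
  element.\<close>

lemma cox_eq_play: "cox_eq S m x y \<Longrightarrow> play x = play y"
  unfolding cox_eq_def
proof (induction rule: equivclp_induct)
  case (step y z)
  have "play y = play z" if "cox_step S m y z" for y z
    using that
    by cases (auto simp: fun_eq_iff concat_replicate_pair play_relator)
  with step show ?case by metis
qed simp

text \<open>As long as the word is no longer than \<open>m s t\<close>, each fired value is a
  combination of \<open>f s\<close> and \<open>f t\<close> with nonnegative Chebyshev coefficients
  that do not both vanish.\<close>

lemma legal_alt_word:
  assumes "s \<in> S" "t \<in> S" "s \<noteq> t" "0 < f s" "0 < f t" "enat n \<le> m s t"
  shows "legal f (alt_word n s t)"
  using assms(6)
proof (induction n)
  case (Suc n)
  note m2 = m_ge_2[OF assms(1-3)]
  have n: "enat n < m s t" using Suc.prems by (meson Suc_ile_eq)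
  have "0 \<le> cheb (m s t) (real (Suc n))" "0 \<le> cheb (m s t) (real n)"
    using cheb_nonneg[OF m2] Suc.prems n less_imp_le by blast+
  moreover have "0 < cheb (m s t) (real (Suc n)) \<or> 0 < cheb (m s t) (real n)"
    using cheb_pos[OF m2 _ n] m2 by (cases "n = 0") auto
  ultimately have "0 < f s * cheb (m s t) (real n + 1) + f t * cheb (m s t) (real n)"
    using assms(4,5) unfolding of_nat_Suc
    by (metis add.commute add_nonneg_pos add_pos_nonneg less_eq_real_def mult_nonneg_nonneg
        mult_pos_pos of_nat_Suc)
  then have "0 < play (alt_word n s t) f (if even n then s else t)"
    by (simp only: play_alt_word[OF assms(1-3)])
  with Suc.IH n show ?case by (simp add: alt_word_snoc legal_append del: alt_word.simps)
qed simp

text \<open>The first letter is fired at \<open>f s\<close>. At the last letter the coefficients are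
  \<open>cheb\<close> at \<open>j\<close> and \<open>j - 1\<close>, that is 0 and 1, so it is fired
  at exactly \<open>f t\<close>.\<close>

lemma legal_braid_pos:
  assumes "s \<in> S" "t \<in> S" "s \<noteq> t" "m s t = enat j" "legal f (alt_word j s t)"
  shows "0 < f s" and "0 < f t"
proof -
  have j: "2 \<le> j" using m_ge_2[of s t] assms by (simp add: numeral_eq_enat)
  then obtain n where n: "j = Suc n" by (cases j) auto
  show "0 < f s" using assms(5) n by simp
  have "0 < play (alt_word n s t) f (if even n then s else t)"
    using assms(5) by (simp add: n alt_word_snoc legal_append del: alt_word.simps)
  also have "\<dots> = f s * cheb (m s t) (real j) + f t * cheb (m s t) (real j - 1)"
    by (simp only: play_alt_word[OF assms(1-3)]) (simp add: n add.commute)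
  also have "cheb (m s t) (real j) = 0"
    using cheb_order[OF j] assms(4) by simp
  also have "cheb (m s t) (real j - 1) = 1"
    using cheb_order_plus[OF j, of "-1"] m_ge_2[OF assms(1-3)] assms(4) by simp
  finally show "0 < f t" by simp
qed

section \<open>Braid moves and their effect on the game\<close>

inductive braid_step :: "'a list \<Rightarrow> 'a list \<Rightarrow> bool" where
  "s \<in> S \<Longrightarrow> t \<in> S \<Longrightarrow> s \<noteq> t \<Longrightarrow> m s t = enat j \<Longrightarrow>
     braid_step (u @ alt_word j s t @ v) (u @ alt_word j t s @ v)"

abbreviation braid_eq :: "'a list \<Rightarrow> 'a list \<Rightarrow> bool" where
  "braid_eq \<equiv> equivclp braid_step"

lemma braid_step_sym: "braid_step x y \<Longrightarrow> braid_step y x"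
  by (erule braid_step.cases) (metis braid_step.intros m_sym)

lemma braid_eq_induct [consumes 1, case_names refl step]:
  assumes "braid_eq x y" "P x"
    and "\<And>y z. braid_eq x y \<Longrightarrow> braid_step y z \<Longrightarrow> P y \<Longrightarrow> P z"
  shows "P y"
  using assms by (induction rule: equivclp_induct) (blast intro: braid_step_sym)+

lemma braid_step_context: "braid_step x y \<Longrightarrow> braid_step (u @ x @ v) (u @ y @ v)"
proof (erule braid_step.cases)
  fix s t j u' v'
  assume "x = u' @ alt_word j s t @ v'" "y = u' @ alt_word j t s @ v'"
    "s \<in> S" "t \<in> S" "s \<noteq> t" "m s t = enat j"
  then show ?thesis using braid_step.intros[of s t j "u @ u'" "v' @ v"] by simp
qed

lemma braid_eq_context: "braid_eq x y \<Longrightarrow> braid_eq (u @ x @ v) (u @ y @ v)"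
  using equivclp_append_context[of braid_step, OF braid_step_context] .

lemma cox_step_context: "cox_step S m x y \<Longrightarrow> cox_step S m (u @ x @ v) (u @ y @ v)"
proof (erule cox_step.cases)
  fix s t j u' v'
  assume "x = u' @ concat (replicate j [s, t]) @ v'" "y = u' @ v'"
    "s \<in> S" "t \<in> S" "m s t = enat j"
  then show ?thesis using cox_step.intros[of s S t m j "u @ u'" "v' @ v"] by simp
qed

lemma cox_eq_context: "cox_eq S m x y \<Longrightarrow> cox_eq S m (u @ x @ v) (u @ y @ v)"
  unfolding cox_eq_def using equivclp_append_context[of "cox_step S m", OF cox_step_context] .

lemma cox_eq_trans: "cox_eq S m x y \<Longrightarrow> cox_eq S m y z \<Longrightarrow> cox_eq S m x z"
  unfolding cox_eq_def by (rule equivclp_trans)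

lemma cox_eq_sym: "cox_eq S m x y \<Longrightarrow> cox_eq S m y x"
  unfolding cox_eq_def by (rule equivclp_sym)

lemma cox_eq_refl [simp]: "cox_eq S m x x"
  unfolding cox_eq_def by simp

lemma cox_eq_square: "s \<in> S \<Longrightarrow> cox_eq S m (u @ [s, s] @ v) (u @ v)"
  using cox_step.intros[of s S s m 1 u v] by (auto simp: cox_eq_def one_enat_def)

lemma cox_eq_append_rev: "w \<in> lists S \<Longrightarrow> cox_eq S m (w @ rev w) []"
proof (induction w)
  case (Cons s w)
  then have "cox_eq S m ([s] @ (w @ rev w) @ [s]) ([s] @ [] @ [s])"
    by (intro cox_eq_context) simp
  with Cons.prems cox_eq_square[of s "[]" "[]"] show ?case
    by (auto intro: cox_eq_trans)
qed simp

text \<open>The relator is \<open>alt_word j s t\<close> followed by the inverse of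
  \<open>alt_word j t s\<close>. Appending \<open>alt_word j t s\<close> and cancelling in the two
  possible ways yields both sides.\<close>

lemma cox_eq_braid:
  assumes "s \<in> S" "t \<in> S" "m s t = enat j"
  shows "cox_eq S m (alt_word j s t) (alt_word j t s)"
proof -
  have "rev (alt_word j t s) \<in> lists S"
    using alt_word_in_lists[OF assms(2,1)] by (auto simp: in_lists_conv_set)
  from cox_eq_append_rev[OF this]
  have "cox_eq S m (alt_word j s t @ rev (alt_word j t s) @ alt_word j t s) (alt_word j s t)"
    using cox_eq_context[of _ "[]" "alt_word j s t" "[]"] by simp
  moreover have "cox_eq S m (alt_word (2 * j) s t @ alt_word j t s) (alt_word j t s)"
    using cox_step.intros[of s S t m j "[]" "alt_word j t s"] assms
    by (auto simp: cox_eq_def concat_replicate_pair)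
  ultimately show ?thesis
    by (metis alt_word_double append.assoc cox_eq_sym cox_eq_trans)
qed

lemma braid_eq_imp_cox_eq: "braid_eq x y \<Longrightarrow> cox_eq S m x y"
proof (induction rule: braid_eq_induct)
  case (step y z)
  from step.hyps(2) have "cox_eq S m y z"
    by cases (simp add: cox_eq_context cox_eq_braid)
  with step show ?case by (blast intro: cox_eq_trans)
qed simp

lemma braid_eq_play: "braid_eq x y \<Longrightarrow> play x = play y"
  by (rule cox_eq_play[OF braid_eq_imp_cox_eq])

lemma braid_eq_length: "braid_eq x y \<Longrightarrow> length x = length y"
  by (induction rule: braid_eq_induct) (auto elim!: braid_step.cases)

lemma braid_eq_lists: "braid_eq x y \<Longrightarrow> x \<in> lists S \<Longrightarrow> y \<in> lists S"
  by (induction rule: braid_eq_induct) (auto elim!: braid_step.cases dest!: subsetD[OF set_alt_word_subset])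

text \<open>A full braid word is legal exactly when both coordinates \<open>s\<close> and
  \<open>t\<close> are positive, a condition symmetric in the two letters; both sides of the move
  reach the same position, so the remaining letters are unaffected.\<close>

lemma braid_eq_legal: "braid_eq x y \<Longrightarrow> legal f x \<Longrightarrow> legal f y"
proof (induction rule: braid_eq_induct)
  case (step y z)
  from step.hyps(2) show ?case
  proof cases
    case (1 s t j u v)
    have "braid_step (u @ alt_word j s t @ []) (u @ alt_word j t s @ [])"
      by (rule braid_step.intros) fact+
    then have "play (u @ alt_word j s t) = play (u @ alt_word j t s)"
      using braid_eq_play by fastforce
    then have "play (alt_word j s t) (play u f) = play (alt_word j t s) (play u f)"
      by (simp add: fun_eq_iff)
    with 1 step legal_braid_pos[of s t j "play u f"] legal_alt_word[of t s "play u f" j] m_sym[of s t]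
    show ?thesis by (auto simp: legal_append)
  qed
qed

subsection \<open>The word problem\<close>

abbreviation start :: "'a \<Rightarrow> real" where
  "start \<equiv> \<lambda>_. 1"

lemma legal_snoc_neg: "legal f (w @ [s]) \<Longrightarrow> play (w @ [s]) f s < 0"
  by (simp add: legal_append)

text \<open>Among all words \<open>u @ x\<close> braid equivalent to \<open>w\<close> with \<open>x\<close> alternating in \<open>s\<close> and the last
  letter of \<open>w\<close> and not ending in \<open>s\<close>, one with \<open>u\<close> shortest is considered: by induction both
  coordinates are positive after \<open>u\<close>, so that the sign of the coordinate \<open>s\<close> after \<open>x\<close> is known.\<close>

lemma legal_sign_dichotomy:
  assumes "w \<in> lists S" "s \<in> S" "legal start w"
  shows "0 < play w start s \<or> play w start s < 0 \<and> (\<exists>w'. braid_eq w (w' @ [s]))"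
  using assms
proof (induction w arbitrary: s rule: measure_induct_rule[of length])
  case (less w)
  show ?case
  proof (cases w rule: rev_cases)
    case Nil
    then show ?thesis by simp
  next
    case (snoc w0 t)
    show ?thesis
    proof (cases "t = s")
      case True
      with less.prems(3) snoc legal_snoc_neg[of start w0 s] show ?thesis
        by (intro disjI2 conjI exI[of _ w0]) simp_all
    next
      case False
      \<comment> \<open>The conditional is the letter that would continue the alternating word;
        requiring it to be \<open>s\<close> makes the nonempty word end in \<open>t\<close>.\<close>
      define P where "P u \<longleftrightarrow> (\<exists>p q n. {p, q} = {s, t} \<and> 0 < n \<and> (if even n then p else q) = s
        \<and> braid_eq w (u @ alt_word n p q))" for u
      have "P w0"
        unfolding P_def by (intro exI[of _ t] exI[of _ s] exI[of _ 1]) (simp add: snoc insert_commute)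
      then obtain u where "P u" and u_min: "\<And>u'. P u' \<Longrightarrow> length u \<le> length u'"
        using ex_has_least_nat[of P w0 length] by auto
      then obtain p q n where pq: "{p, q} = {s, t}" and n: "0 < n"
        and s: "(if even n then p else q) = s" and w: "braid_eq w (u @ alt_word n p q)"
        unfolding P_def by blast
      have S: "p \<in> S" "q \<in> S" "p \<noteq> q"
        using pq less.prems(1,2) snoc False by (auto simp: doubleton_eq_iff)
      have legal: "legal start u" "legal (play u start) (alt_word n p q)"
        using braid_eq_legal[OF w less.prems(3)] by (auto simp: legal_append)
      have p: "0 < play u start p"
        using legal(2) n by (cases n) auto
      have u: "u \<in> lists S" "length u < length w"
        using braid_eq_lists[OF w less.prems(1)] braid_eq_length[OF w] n by auto
      \<comment> \<open>Otherwise \<open>q\<close> could be moved into the alternating word,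
        contradicting the minimality of \<open>u\<close>.\<close>
      have "\<not> braid_eq u (u' @ [q])" for u'
      proof
        assume u': "braid_eq u (u' @ [q])"
        have "braid_eq w (u' @ alt_word (Suc n) q p)"
          using equivclp_trans[OF w] braid_eq_context[OF u', of "[]" "alt_word n p q"] by simp
        moreover have "{q, p} = {s, t}" "(if even (Suc n) then q else p) = s"
          using pq s by (simp_all add: insert_commute split: if_splits)
        ultimately have "P u'" unfolding P_def by blast
        with u_min[of u'] braid_eq_length[OF u'] show False by simp
      qed
      with less.IH[OF u(2,1) S(2) legal(1)] have q: "0 < play u start q" by blast
      let ?c = "cheb (m p q)"
      have "play w start = play (alt_word n p q) (play u start)"
        using braid_eq_play[OF w] by simp
      then have val: "play w start s
          = play u start p * ?c (real n + 1) + play u start q * ?c (real n)"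
        using play_alt_word(1)[OF S, of n "play u start"] s by simp
      note m2 = m_ge_2[OF S]
      show ?thesis
      proof (cases "enat n < m p q")
        case True
        then have "0 < ?c (real n)" "0 \<le> ?c (real n + 1)"
          using cheb_pos[OF m2 n] cheb_nonneg[OF m2, of "Suc n"]
          by (auto simp: Suc_ile_eq add.commute)
        with p q have "0 < play w start s"
          unfolding val by (intro add_nonneg_pos) auto
        then show ?thesis by blast
      next
        case False
        then obtain j where j: "m p q = enat j" "j \<le> n" by (cases "m p q") auto
        have j2: "2 \<le> j" using m2 j by (simp add: numeral_eq_enat)
        have cj: "?c (real j) = 0" "?c (real j + 1) = - 1"
          using cheb_order[OF j2] cheb_order_plus[OF j2, of 1] m2 by (simp_all add: j(1))
        \<comment> \<open>In a longer word the letter after the first \<open>j\<close> would be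
          fired at \<open>- play u start p\<close>, which is negative.\<close>
        have "j = n"
        proof (rule ccontr)
          assume "j \<noteq> n"
          then obtain i where i: "n = j + Suc i"
            using j(2) less_imp_Suc_add by (metis add_Suc_right le_neq_implies_less)
          have "0 < play (alt_word j p q) (play u start) (if even j then p else q)"
            using legal(2) unfolding i alt_word_add[of j "Suc i"] by (auto simp: legal_append)
          then show False
            using play_alt_word(1)[OF S, of j "play u start"] cj p by simp
        qed
        have "play w start s < 0"
          unfolding val using cj p \<open>j = n\<close> by simp
        moreover obtain k where k: "n = Suc k" using n by (cases n) auto
        \<comment> \<open>The alternating word is now a full braid word, and the other side of its
          braid relation ends in \<open>s\<close>.\<close>
        have "braid_eq (u @ alt_word n p q @ []) (u @ alt_word n q p @ [])"
          using braid_step.intros[OF S, of n u "[]"] j(1) \<open>j = n\<close> by blast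
        then have "braid_eq w (u @ alt_word n q p)"
          using equivclp_trans[OF w] by simp
        moreover have "alt_word n q p = alt_word k q p @ [s]"
          using s unfolding k by (subst alt_word_snoc) auto
        ultimately show ?thesis by (metis append.assoc)
      qed
    qed
  qed
qed

text \<open>Just before the first illegal letter \<open>s\<close> the coordinate \<open>s\<close> is
  not positive, so by the sign dichotomy the legal prefix can be braided to end in \<open>s\<close>,
  which creates \<open>ss\<close>.\<close>

lemma not_legal_imp_square:
  assumes "w \<in> lists S" "\<not> legal start w"
  obtains u r v where "r \<in> S" "braid_eq w (u @ [r, r] @ v)"
proof -
  have "\<exists>u r v. r \<in> S \<and> braid_eq w (u @ [r, r] @ v)"
    using assms
  proof (induction w rule: rev_induct)
    case (snoc s w)
    show ?case
    proof (cases "legal start w")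
      case True
      with snoc.prems legal_sign_dichotomy[of w s] obtain w' where "braid_eq w (w' @ [s])"
        by (auto simp: legal_append)
      from braid_eq_context[OF this, of "[]" "[s]"] snoc.prems show ?thesis
        by (intro exI[of _ w'] exI[of _ s] exI[of _ "[]"]) auto
    next
      case False
      with snoc obtain u r v where "r \<in> S" "braid_eq w (u @ [r, r] @ v)" by auto
      with braid_eq_context[OF this(2), of "[]" "[s]"] show ?thesis
        by (intro exI[of _ u] exI[of _ r] exI[of _ "v @ [s]"]) auto
    qed
  qed simp
  then show thesis using that by blast
qed

text \<open>The last letter \<open>s\<close> of \<open>w\<close> has a negative final coordinate, so
  \<open>w'\<close> can also be braided to end in \<open>s\<close>. Firing \<open>s\<close> again
  undoes it in both games, and induction applies. The starting position has no negative coordinate,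
  which settles the empty word.\<close>

lemma legal_same_play_imp_braid_eq:
  assumes "w \<in> lists S" "w' \<in> lists S" "legal start w" "legal start w'"
    and "play w start = play w' start"
  shows "braid_eq w w'"
  using assms
proof (induction w arbitrary: w' rule: rev_induct)
  case Nil
  have "w' = []"
  proof (cases w' rule: rev_cases)
    case (snoc v s)
    then show ?thesis using legal_snoc_neg[of start v s] Nil.prems(4) fun_cong[OF Nil.prems(5), of s] by simp
  qed
  then show ?case by simp
next
  case (snoc s w)
  have "play w' start s < 0"
    using legal_snoc_neg[OF snoc.prems(3)] unfolding snoc.prems(5) .
  with legal_sign_dichotomy[of w' s] snoc.prems obtain v where v: "braid_eq w' (v @ [s])"
    by force
  have "fire s (play w start) = fire s (play v start)"
    using snoc.prems(5) braid_eq_play[OF v] by simp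
  then have "play w start = play v start"
    by (metis fire_fire)
  moreover have "v \<in> lists S" "legal start v"
    using braid_eq_lists[OF v snoc.prems(2)] braid_eq_legal[OF v snoc.prems(4)]
    by (auto simp: legal_append)
  ultimately have "braid_eq w v"
    using snoc.IH[of v] snoc.prems by (auto simp: legal_append)
  from braid_eq_context[OF this, of "[]" "[s]"] have "braid_eq (w @ [s]) (v @ [s])" by simp
  from equivclp_trans[OF this equivclp_sym[OF v]] show ?case .
qed

section \<open>Reduced expressions are the legal words\<close>

lemma cox_length_le: "v \<in> cox_elem S m u \<Longrightarrow> cox_length S m u \<le> length v"
  unfolding cox_length_def by (rule Least_le) auto

lemma reduced_exprs_nonempty:
  assumes "u \<in> lists S"
  shows "\<exists>v. v \<in> reduced_exprs S m u"
proof -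
  have "\<exists>v\<in>cox_elem S m u. length v = length u"
    using assms by (auto simp: cox_elem_def)
  then have "\<exists>v\<in>cox_elem S m u. length v = cox_length S m u"
    unfolding cox_length_def by (rule LeastI)
  then show ?thesis by (auto simp: reduced_exprs_def)
qed

text \<open>An illegal word can be braided to contain a square, whose deletion gives a shorter word
  for the same element.\<close>

lemma reduced_imp_legal:
  assumes "w \<in> reduced_exprs S m u"
  shows "legal start w"
proof (rule ccontr)
  from assms have w: "w \<in> lists S" "cox_eq S m w u" "length w = cox_length S m u"
    by (auto simp: reduced_exprs_def cox_elem_def)
  assume "\<not> legal start w"
  then obtain x r y where r: "r \<in> S" "braid_eq w (x @ [r, r] @ y)"
    by (rule not_legal_imp_square[OF w(1)])
  have "cox_eq S m (x @ y) u"
    by (rule cox_eq_trans[OF cox_eq_sym[OF cox_eq_square[OF r(1)]]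
          cox_eq_trans[OF cox_eq_sym[OF braid_eq_imp_cox_eq[OF r(2)]] w(2)]])
  moreover have "x @ y \<in> lists S" using braid_eq_lists[OF r(2) w(1)] by simp
  ultimately have "cox_length S m u \<le> length (x @ y)"
    by (intro cox_length_le) (simp add: cox_elem_def)
  with w(3) braid_eq_length[OF r(2)] show False by simp
qed

lemma legal_cox_eq_imp_braid_eq:
  assumes "w \<in> lists S" "w' \<in> lists S" "legal start w" "legal start w'" "cox_eq S m w w'"
  shows "braid_eq w w'"
  using assms(1-4) by (rule legal_same_play_imp_braid_eq) (simp add: cox_eq_play[OF assms(5)])

text \<open>Some reduced expression \<open>v\<close> of the same element exists and is legal, hence
  braid equivalent to \<open>w\<close>; braid moves preserve length.\<close>

lemma legal_imp_reduced:
  assumes "w \<in> lists S" "legal start w"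
  shows "w \<in> reduced_exprs S m w"
proof -
  obtain v where v: "v \<in> reduced_exprs S m w"
    using reduced_exprs_nonempty assms(1) by blast
  then have "v \<in> lists S" "cox_eq S m v w" "length v = cox_length S m w"
    by (auto simp: reduced_exprs_def cox_elem_def)
  moreover from this have "braid_eq v w"
    using assms reduced_imp_legal[OF v] by (intro legal_cox_eq_imp_braid_eq)
  ultimately show ?thesis
    using assms(1) braid_eq_length[of v w] by (simp add: reduced_exprs_def cox_elem_def)
qed

subsection \<open>Commutation classes of words of fully commutative elements\<close>

text \<open>The bound \<open>3 \<le> j\<close> leaves out the braid words with \<open>j = 2\<close>,
  where the braid move is itself a commutation.\<close>

definition bad_words :: "'a list set" where
  "bad_words = {[s, s] | s. s \<in> S} \<union>
     {alt_word j s t | s t j. s \<in> S \<and> t \<in> S \<and> s \<noteq> t \<and> m s t = enat j \<and> 3 \<le> j}"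

definition good :: "'a list \<Rightarrow> bool" where
  "good w \<longleftrightarrow> w \<in> lists S \<and> (\<forall>u x v. comm_eq S m w (u @ x @ v) \<longrightarrow> x \<notin> bad_words)"

lemma finite_bad_words: "finite bad_words"
proof (rule finite_subset)
  show "bad_words \<subseteq> (\<lambda>s. [s, s]) ` S \<union> (\<lambda>(s, t). alt_word (the_enat (m s t)) s t) ` (S \<times> S)"
    by (force simp: bad_words_def)
qed (simp add: finite_S)

lemma comm_eq_trans: "comm_eq S m x y \<Longrightarrow> comm_eq S m y z \<Longrightarrow> comm_eq S m x z"
  unfolding comm_eq_def by (rule equivclp_trans)

lemma comm_eq_sym: "comm_eq S m x y \<Longrightarrow> comm_eq S m y x"
  unfolding comm_eq_def by (rule equivclp_sym)

lemma comm_eq_refl [simp]: "comm_eq S m x x"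
  unfolding comm_eq_def by simp

lemma comm_step_sym: "comm_step S m x y \<Longrightarrow> comm_step S m y x"
  by (erule comm_step.cases) (metis comm_step.intros m_sym)

lemma comm_eq_induct [consumes 1, case_names refl step]:
  assumes "comm_eq S m x y" "P x"
    and "\<And>y z. comm_eq S m x y \<Longrightarrow> comm_step S m y z \<Longrightarrow> P y \<Longrightarrow> P z"
  shows "P y"
  using assms unfolding comm_eq_def
  by (induction rule: equivclp_induct) (blast intro: comm_step_sym)+

lemma comm_step_context: "comm_step S m x y \<Longrightarrow> comm_step S m (u @ x @ v) (u @ y @ v)"
proof (erule comm_step.cases)
  fix s t u' v'
  assume "x = u' @ [s, t] @ v'" "y = u' @ [t, s] @ v'" "s \<in> S" "t \<in> S" "m s t = 2"
  then show ?thesis using comm_step.intros[of s S t m "u @ u'" "v' @ v"] by simp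
qed

lemma comm_eq_context: "comm_eq S m x y \<Longrightarrow> comm_eq S m (u @ x @ v) (u @ y @ v)"
  unfolding comm_eq_def using equivclp_append_context[of "comm_step S m", OF comm_step_context] .

lemma comm_eq_append: "comm_eq S m x y \<Longrightarrow> comm_eq S m (x @ v) (y @ v)"
  using comm_eq_context[of x y "[]" v] by simp

lemma comm_step_imp_braid_step: "comm_step S m x y \<Longrightarrow> braid_step x y"
proof (erule comm_step.cases)
  fix s t u v
  assume *: "x = u @ [s, t] @ v" "y = u @ [t, s] @ v" "s \<in> S" "t \<in> S" "m s t = 2"
  then have "s \<noteq> t" by (auto simp: one_enat_def numeral_eq_enat)
  with * braid_step.intros[of s t 2 u v] show ?thesis
    by (simp add: numeral_eq_enat numeral_2_eq_2)
qed

lemma comm_eq_imp_braid_eq: "comm_eq S m x y \<Longrightarrow> braid_eq x y"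
  by (induction rule: comm_eq_induct)
     (auto intro: equivclp_into_equivclp comm_step_imp_braid_step)

lemma comm_eq_length: "comm_eq S m x y \<Longrightarrow> length x = length y"
  by (blast dest: comm_eq_imp_braid_eq braid_eq_length)

lemma comm_eq_lists: "comm_eq S m x y \<Longrightarrow> x \<in> lists S \<Longrightarrow> y \<in> lists S"
  by (blast dest: comm_eq_imp_braid_eq braid_eq_lists)

lemma comm_eq_good: "comm_eq S m x y \<Longrightarrow> good x \<Longrightarrow> good y"
  unfolding good_def using comm_eq_lists comm_eq_trans by metis

text \<open>No braid word of length at least 3 appears anywhere in the commutation class, so every
  braid move that can be applied is a commutation.\<close>

lemma good_braid_eq_imp_comm_eq:
  assumes "braid_eq x y" "good x"
  shows "comm_eq S m x y"
  using assms(1)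
proof (induction rule: braid_eq_induct)
  case (step y z)
  from step.hyps(2) show ?case
  proof cases
    case (1 s t j u v)
    have "alt_word j s t \<notin> bad_words"
      using assms(2) step.IH unfolding good_def 1(1) by blast
    then have "\<not> 3 \<le> j" using 1 by (auto simp: bad_words_def)
    moreover have "2 \<le> j" using m_ge_2[OF 1(3-5)] 1(6) by (simp add: numeral_eq_enat)
    ultimately have "j = 2" by simp
    then have "comm_step S m y z"
      using comm_step.intros[of s S t m u v] 1 by (simp add: numeral_eq_enat numeral_2_eq_2)
    with step.IH show ?thesis
      unfolding comm_eq_def by (blast intro: equivclp_into_equivclp)
  qed
qed simp

lemma good_imp_legal:
  assumes "good w"
  shows "legal start w"
proof (rule ccontr)
  assume "\<not> legal start w"
  moreover have "w \<in> lists S" using assms by (simp add: good_def)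
  ultimately obtain u r v where r: "r \<in> S" "braid_eq w (u @ [r, r] @ v)"
    by (elim not_legal_imp_square)
  with good_braid_eq_imp_comm_eq assms have "comm_eq S m w (u @ [r, r] @ v)" by blast
  moreover have "[r, r] \<in> bad_words" using r by (simp add: bad_words_def)
  ultimately show False using assms unfolding good_def by blast
qed

text \<open>Commutations never exchange \<open>s\<close> with \<open>t\<close>. The resulting
  invariant separates the two sides of a long braid relation.\<close>

lemma comm_eq_filter_pair:
  assumes "comm_eq S m x y" "m s t \<noteq> 2" "s \<in> S" "t \<in> S"
  shows "filter (\<lambda>r. r \<in> {s, t}) x = filter (\<lambda>r. r \<in> {s, t}) y"
  using assms(1)
proof (induction rule: comm_eq_induct)
  case (step y z)
  from step.hyps(2) have "filter (\<lambda>r. r \<in> {s, t}) y = filter (\<lambda>r. r \<in> {s, t}) z"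
    by cases (use assms(2-) m_sym in auto)
  with step.IH show ?case by simp
qed simp

text \<open>A square would be illegal, as its second letter is fired at a negative value. A long
  braid word would lead to another reduced expression with a different order of \<open>s\<close> and
  \<open>t\<close>, hence in another commutation class.\<close>

lemma fully_commutative_reduced_good:
  assumes "fully_commutative S m u" "w \<in> reduced_exprs S m u"
  shows "good w"
proof -
  have w: "w \<in> lists S" "cox_eq S m w u" "length w = cox_length S m u"
    using assms(2) by (auto simp: reduced_exprs_def cox_elem_def)
  have red: "z \<in> reduced_exprs S m u" if "braid_eq w z" for z
    using that w braid_eq_lists[OF that] braid_eq_length[OF that]
      cox_eq_trans[OF cox_eq_sym[OF braid_eq_imp_cox_eq[OF that]]]
    by (auto simp: reduced_exprs_def cox_elem_def)
  have "x \<notin> bad_words" if y: "comm_eq S m w (a @ x @ b)" for a x b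
  proof
    note y = comm_eq_imp_braid_eq[OF y]
    assume "x \<in> bad_words"
    then consider s where "s \<in> S" "x = [s, s]"
      | s t j where "s \<in> S" "t \<in> S" "s \<noteq> t" "m s t = enat j" "3 \<le> j" "x = alt_word j s t"
      unfolding bad_words_def by blast
    then show False
    proof cases
      case 1
      then show False
        using reduced_imp_legal[OF red[OF y]] by (auto simp: legal_append)
    next
      case 2
      let ?f = "filter (\<lambda>r. r \<in> {s, t})"
      have "braid_step (a @ x @ b) (a @ alt_word j t s @ b)"
        using 2 braid_step.intros by blast
      with y have "a @ alt_word j t s @ b \<in> reduced_exprs S m u"
        by (blast intro: red equivclp_into_equivclp)
      with red[OF y] assms(1) have "comm_eq S m (a @ x @ b) (a @ alt_word j t s @ b)"
        by (simp add: fully_commutative_def)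
      then have "?f (a @ x @ b) = ?f (a @ alt_word j t s @ b)"
        using 2 by (intro comm_eq_filter_pair) (auto simp: numeral_eq_enat)
      then have "?f (alt_word j s t) = ?f (alt_word j t s)"
        using 2 by simp
      moreover have "?f (alt_word j s t) = alt_word j s t" "?f (alt_word j t s) = alt_word j t s"
        using set_alt_word_subset by (auto simp: filter_id_conv dest!: subsetD[OF set_alt_word_subset])
      ultimately have "alt_word j s t = alt_word j t s" by simp
      with 2 show False by (cases j) auto
    qed
  qed
  with w(1) show ?thesis by (simp add: good_def)
qed

lemma cox_elem_eq_iff:
  assumes "u \<in> lists S" "v \<in> lists S"
  shows "cox_elem S m u = cox_elem S m v \<longleftrightarrow> cox_eq S m u v"
  using assms cox_eq_trans[of _ u v] cox_eq_trans[of _ v u] cox_eq_sym[of u v]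
    cox_eq_refl[of u] unfolding cox_elem_def by blast

lemma good_cox_elem_eq_iff:
  assumes "good u" "good v"
  shows "cox_elem S m u = cox_elem S m v \<longleftrightarrow> comm_eq S m u v"
proof -
  have "u \<in> lists S" "v \<in> lists S" using assms by (auto simp: good_def)
  then show ?thesis
    using assms cox_elem_eq_iff good_imp_legal legal_cox_eq_imp_braid_eq good_braid_eq_imp_comm_eq
      comm_eq_imp_braid_eq braid_eq_imp_cox_eq by metis
qed

text \<open>A good word is legal, hence reduced, and every other reduced expression of its element
  is braid equivalent to it, which for good words means commutation equivalent. The other inclusion
  takes any reduced expression.\<close>

lemma FC_elems_eq_image: "FC_elems S m l = cox_elem S m ` {w. good w \<and> length w = l}"
proof (intro equalityI subsetI)
  fix E
  assume "E \<in> FC_elems S m l"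
  then obtain u where u: "u \<in> lists S" "cox_length S m u = l" "fully_commutative S m u"
    "E = cox_elem S m u"
    unfolding FC_elems_def by blast
  then obtain w where w: "w \<in> reduced_exprs S m u" using reduced_exprs_nonempty by blast
  then have "w \<in> lists S" "cox_eq S m w u" "length w = l"
    using u(2) by (auto simp: reduced_exprs_def cox_elem_def)
  with u w show "E \<in> cox_elem S m ` {w. good w \<and> length w = l}"
    using fully_commutative_reduced_good cox_elem_eq_iff by blast
next
  fix E
  assume "E \<in> cox_elem S m ` {w. good w \<and> length w = l}"
  then obtain w where w: "good w" "length w = l" "E = cox_elem S m w" by blast
  then have wS: "w \<in> lists S" by (simp add: good_def)
  then have "w \<in> reduced_exprs S m w"
    using legal_imp_reduced good_imp_legal w(1) by blast
  then have "cox_length S m w = l"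
    using w(2) by (simp add: reduced_exprs_def)
  moreover have "comm_eq S m w v" if v: "v \<in> reduced_exprs S m w" for v
  proof -
    have "v \<in> lists S" "cox_eq S m v w" using v by (auto simp: reduced_exprs_def cox_elem_def)
    then have "braid_eq w v"
      using wS reduced_imp_legal[OF v] good_imp_legal[OF w(1)] cox_eq_sym
      by (intro legal_cox_eq_imp_braid_eq) auto
    then show ?thesis using good_braid_eq_imp_comm_eq w(1) by blast
  qed
  then have "fully_commutative S m w"
    unfolding fully_commutative_def using comm_eq_trans comm_eq_sym by metis
  ultimately show "E \<in> FC_elems S m l"
    using w(3) wS unfolding FC_elems_def by blast
qed

subsection \<open>A finite automaton for good words\<close>

definition commuting :: "'a \<Rightarrow> 'a set" where
  "commuting r = {t \<in> S. m r t = 2}"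

lemma commuting_irrefl: "r \<in> S \<Longrightarrow> r \<notin> commuting r"
  by (simp add: commuting_def one_enat_def numeral_eq_enat)

lemma comm_eq_move:
  assumes "r \<in> S" "set y \<subseteq> commuting r"
  shows "comm_eq S m (x @ y @ [r]) (x @ r # y)"
  using assms(2)
proof (induction y arbitrary: x)
  case (Cons t y)
  have "comm_step S m (x @ [r, t] @ y) (x @ [t, r] @ y)"
    using Cons.prems assms(1) by (intro comm_step.intros) (auto simp: commuting_def)
  then have "comm_eq S m (x @ [t, r] @ y) (x @ [r, t] @ y)"
    unfolding comm_eq_def by (rule converse_r_into_equivclp)
  moreover have "comm_eq S m ((x @ [t]) @ y @ [r]) ((x @ [t]) @ r # y)"
    using Cons.prems by (intro Cons.IH) simp
  ultimately show ?case using comm_eq_trans by simp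
qed simp

text \<open>The appended occurrence of \<open>r\<close> is followed through the commutation steps:
  the letters to its right are those it has passed, and deleting it leaves a word equivalent to
  \<open>w\<close>.\<close>

lemma comm_eq_snoc:
  assumes "comm_eq S m (w @ [r]) y" "r \<in> S"
  shows "\<exists>y1 y2. y = y1 @ r # y2 \<and> set y2 \<subseteq> commuting r \<and> comm_eq S m w (y1 @ y2)"
  using assms(1)
proof (induction rule: comm_eq_induct)
  case refl
  show ?case by (intro exI[of _ w] exI[of _ "[]"]) simp
next
  case (step y z)
  then obtain y1 y2 where y: "y = y1 @ r # y2" "set y2 \<subseteq> commuting r" "comm_eq S m w (y1 @ y2)"
    by blast
  from step.hyps(2) show ?case
  proof cases
    case (1 s t u v)
    have ts: "comm_eq S m w (a @ s # t # b) \<Longrightarrow> comm_eq S m w (a @ t # s # b)" for a b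
      using comm_step.intros[of s S t m a b] 1(3-5)
      by (auto simp: comm_eq_def intro: equivclp_into_equivclp)
    from y(1) 1(1) have "y1 @ r # y2 = u @ s # t # v" by simp
    then show ?thesis
    proof (cases rule: append_Cons_eq_append_pair_cases)
      case a: (1 v')
      then show ?thesis
        using 1 y ts[of u "v' @ y2"] by (intro exI[of _ "u @ t # s # v'"] exI[of _ y2]) simp
    next
      case 2
      then show ?thesis
        using 1 y m_sym[of s t] by (intro exI[of _ u] exI[of _ "s # v"]) (simp add: commuting_def)
    next
      case 3
      then show ?thesis
        using 1 y by (intro exI[of _ "u @ [t]"] exI[of _ v]) simp
    next
      case (4 u')
      then show ?thesis
        using 1 y ts[of "y1 @ u'" v] by (intro exI[of _ y1] exI[of _ "u' @ t # s # v"]) simp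
    qed
  qed
qed

lemma comm_eq_snoc_cancel:
  assumes "r \<in> S"
  shows "comm_eq S m (w @ [r]) (w' @ [r]) \<longleftrightarrow> comm_eq S m w w'"
proof
  assume "comm_eq S m (w @ [r]) (w' @ [r])"
  from comm_eq_snoc[OF this assms] obtain y1 y2 where
    y: "w' @ [r] = y1 @ r # y2" "set y2 \<subseteq> commuting r" "comm_eq S m w (y1 @ y2)"
    by blast
  \<comment> \<open>A nonempty \<open>y2\<close> would end in \<open>r\<close>, but \<open>r\<close>
    does not commute with itself in the sense of \<open>commuting\<close>.\<close>
  have "y2 = []"
    using y(1,2) commuting_irrefl[OF assms] by (cases y2 rule: rev_cases) auto
  with y show "comm_eq S m w w'" by simp
qed (rule comm_eq_append)

text \<open>For words over \<open>S\<close>, the labels of the maximal elements of the heap of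
  \<open>w\<close>.\<close>

definition descents :: "'a list \<Rightarrow> 'a set" where
  "descents w = {r \<in> S. \<exists>u. comm_eq S m w (u @ [r])}"

lemma descents_snoc:
  assumes "r \<in> S"
  shows "descents (w @ [r]) = insert r (descents w \<inter> commuting r)"
proof (intro equalityI subsetI)
  fix t
  assume t: "t \<in> descents (w @ [r])"
  then obtain u where "comm_eq S m (w @ [r]) (u @ [t])"
    by (auto simp: descents_def)
  from comm_eq_snoc[OF this assms] obtain y1 y2 where
    y: "u @ [t] = y1 @ r # y2" "set y2 \<subseteq> commuting r" "comm_eq S m w (y1 @ y2)"
    by blast
  show "t \<in> insert r (descents w \<inter> commuting r)"
  proof (cases y2 rule: rev_cases)
    case (snoc y3 t')
    then have "t' = t" "comm_eq S m w ((y1 @ y3) @ [t])" "t \<in> commuting r"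
      using y by auto
    with t show ?thesis unfolding descents_def by blast
  qed (use y in simp)
next
  fix t
  assume "t \<in> insert r (descents w \<inter> commuting r)"
  then consider "t = r" | "t \<in> descents w" "t \<in> commuting r" by blast
  then show "t \<in> descents (w @ [r])"
  proof cases
    case 1
    with assms comm_eq_refl[of "w @ [r]"] show ?thesis unfolding descents_def by blast
  next
    case 2
    then obtain u where "comm_eq S m w (u @ [t])" by (auto simp: descents_def)
    from comm_eq_append[OF this, of "[r]"] comm_eq_move[OF assms, of "[t]" u] 2(2)
    have "comm_eq S m (w @ [r]) ((u @ [r]) @ [t])"
      using comm_eq_trans by simp
    with 2 show ?thesis unfolding descents_def by blast
  qed
qed

lemma descents_nonempty:
  assumes "w \<in> lists S" "w \<noteq> []"
  shows "descents w \<noteq> {}"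
proof -
  have "comm_eq S m w (butlast w @ [last w])" "last w \<in> S" using assms by auto
  then show ?thesis unfolding descents_def by blast
qed

lemma descents_cong: "comm_eq S m w w' \<Longrightarrow> descents w = descents w'"
  unfolding descents_def using comm_eq_trans comm_eq_sym by metis

text \<open>The parameter \<open>X\<close> makes the notion computable letter by letter: if an
  appended \<open>r\<close> is to be moved left past everything after the factor, \<open>X\<close>
  shrinks to \<open>X \<inter> commuting r\<close>.\<close>

definition occurs :: "'a list \<Rightarrow> 'a list \<Rightarrow> 'a set \<Rightarrow> bool" where
  "occurs w x X \<longleftrightarrow> (\<exists>u v. comm_eq S m w (u @ x @ v) \<and> set v \<subseteq> X)"

lemma occurs_cong: "comm_eq S m w w' \<Longrightarrow> occurs w x X = occurs w' x X"
  unfolding occurs_def using comm_eq_trans comm_eq_sym by metis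

text \<open>The three alternatives say whether the letter \<open>r\<close> ends up to the right of, to the left
  of, or inside \<open>x\<close>. In the last case it is the end of \<open>x\<close>, since it commutes with everything
  to its right.\<close>

lemma occurs_snoc:
  assumes r: "r \<in> S" and x: "successively (\<lambda>s t. m s t \<noteq> 2) x"
  shows "occurs (w @ [r]) x X \<longleftrightarrow>
    r \<in> X \<and> occurs w x X \<or>
    set x \<subseteq> commuting r \<and> occurs w x (X \<inter> commuting r) \<or>
    x \<noteq> [] \<and> last x = r \<and> occurs w (butlast x) (X \<inter> commuting r)"
    (is "_ \<longleftrightarrow> ?right \<or> ?left \<or> ?inside")
proof
  assume "occurs (w @ [r]) x X"
  then obtain u v where uv: "comm_eq S m (w @ [r]) (u @ x @ v)" "set v \<subseteq> X"
    unfolding occurs_def by blast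
  from comm_eq_snoc[OF uv(1) r] obtain y1 y2 where
    y: "y1 @ r # y2 = u @ x @ v" "set y2 \<subseteq> commuting r" "comm_eq S m w (y1 @ y2)"
    by metis
  from y(1) show "?right \<or> ?left \<or> ?inside"
  proof (cases rule: append_Cons_eq_append3_cases)
    case (1 u')
    then have "comm_eq S m w ((y1 @ u') @ x @ v)" "set x \<subseteq> commuting r"
      "set v \<subseteq> X \<inter> commuting r"
      using y uv(2) by auto
    then show ?thesis unfolding occurs_def by blast
  next
    case (2 x1 x2)
    have "x2 = []"
    proof (cases x2)
      case (Cons t x3)
      with 2 x have "m r t \<noteq> 2" by (auto simp: successively_append_iff)
      moreover have "t \<in> commuting r" using 2 y(2) Cons by simp
      ultimately show ?thesis by (simp add: commuting_def)
    qed
    then have "comm_eq S m w (u @ butlast x @ v)" "x \<noteq> []" "last x = r"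
      "set v \<subseteq> X \<inter> commuting r"
      using 2 y uv(2) by (auto simp: butlast_append)
    then show ?thesis unfolding occurs_def by blast
  next
    case (3 v')
    then have "comm_eq S m w (u @ x @ v' @ y2)" "set (v' @ y2) \<subseteq> X" "r \<in> X"
      using y uv(2) by auto
    then show ?thesis unfolding occurs_def by blast
  qed
next
  assume "?right \<or> ?left \<or> ?inside"
  then consider (right) ?right | (left) ?left | (inside) ?inside by blast
  then show "occurs (w @ [r]) x X"
  proof cases
    case right
    then obtain u v where "comm_eq S m w (u @ x @ v)" "set v \<subseteq> X"
      unfolding occurs_def by blast
    then have "comm_eq S m (w @ [r]) (u @ x @ v @ [r])" "set (v @ [r]) \<subseteq> X"
      using comm_eq_append[of w "u @ x @ v" "[r]"] right by auto
    then show ?thesis unfolding occurs_def by blast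
  next
    case left
    then obtain u v where uv: "comm_eq S m w (u @ x @ v)" "set v \<subseteq> X \<inter> commuting r"
      unfolding occurs_def by blast
    have "comm_eq S m (w @ [r]) ((u @ [r]) @ x @ v)"
      using comm_eq_trans[OF comm_eq_append[OF uv(1), of "[r]"]]
        comm_eq_move[OF r, of "x @ v" u] uv(2) left by simp
    with uv(2) show ?thesis unfolding occurs_def by blast
  next
    case inside
    then obtain u v where uv: "comm_eq S m w (u @ butlast x @ v)" "set v \<subseteq> X \<inter> commuting r"
      unfolding occurs_def by blast
    obtain y where y: "x = y @ [r]"
      using inside by (metis append_butlast_last_id)
    then have "comm_eq S m (w @ [r]) (u @ x @ v)"
      using comm_eq_trans[OF comm_eq_append[OF uv(1), of "[r]"]]
        comm_eq_move[OF r, of v "u @ y"] uv(2) by simp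
    with uv(2) show ?thesis unfolding occurs_def by blast
  qed
qed

text \<open>Prefixes are included because \<open>occurs_snoc\<close> reduces a factor ending in the
  new letter to its \<open>butlast\<close>.\<close>

definition bad_prefixes :: "'a list set" where
  "bad_prefixes = (\<Union>x\<in>bad_words. (\<lambda>i. take i x) ` {..length x})"

lemma finite_bad_prefixes: "finite bad_prefixes"
  by (simp add: bad_prefixes_def finite_bad_words)

lemma bad_words_subset_bad_prefixes: "bad_words \<subseteq> bad_prefixes"
  by (force simp: bad_prefixes_def)

lemma butlast_bad_prefixes: "x \<in> bad_prefixes \<Longrightarrow> butlast x \<in> bad_prefixes"
proof -
  assume "x \<in> bad_prefixes"
  then obtain y i where "y \<in> bad_words" "i \<le> length y" "x = take i y"
    by (auto simp: bad_prefixes_def)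
  moreover from this have "butlast x = take (i - 1) y" by (simp add: butlast_take)
  ultimately show ?thesis unfolding bad_prefixes_def by force
qed

lemma successively_alt_word:
  "m s t \<noteq> 2 \<Longrightarrow> m t s \<noteq> 2 \<Longrightarrow> successively (\<lambda>s t. m s t \<noteq> 2) (alt_word n s t)"
proof (induction n arbitrary: s t)
  case (Suc n)
  then show ?case by (cases n) auto
qed simp

lemma successively_bad_prefixes:
  assumes "x \<in> bad_prefixes"
  shows "successively (\<lambda>s t. m s t \<noteq> 2) x"
proof -
  from assms obtain y i where y: "y \<in> bad_words" "x = take i y"
    by (auto simp: bad_prefixes_def)
  have "m t s \<noteq> 2" if "s \<in> S" "t \<in> S" "m s t = enat j" "3 \<le> j" for s t j
    using that m_sym[of s t] by (auto simp: numeral_eq_enat)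
  moreover have "enat j \<noteq> 2" if "3 \<le> j" for j
    using that by (auto simp: numeral_eq_enat)
  moreover have "m s s \<noteq> 2" if "s \<in> S" for s
    using that by (simp add: one_enat_def numeral_eq_enat)
  ultimately have "successively (\<lambda>s t. m s t \<noteq> 2) y"
    using y(1) unfolding bad_words_def by (auto intro!: successively_alt_word)
  then have "successively (\<lambda>s t. m s t \<noteq> 2) (take i y @ drop i y)" by simp
  then show ?thesis unfolding y(2) successively_append_iff by blast
qed

section \<open>States and transitions\<close>

type_synonym 'b state = "('b list \<times> 'b set) set \<times> 'b set"

definition state :: "'a list \<Rightarrow> 'a state" where
  "state w = ({(x, X). x \<in> bad_prefixes \<and> X \<subseteq> S \<and> occurs w x X}, descents w)"

definition states :: "'a state set" where
  "states = Pow (bad_prefixes \<times> Pow S) \<times> Pow S"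

definition transition :: "'a state \<Rightarrow> 'a \<Rightarrow> 'a state" where
  "transition q r =
    ({(x, X). x \<in> bad_prefixes \<and> X \<subseteq> S \<and>
       (r \<in> X \<and> (x, X) \<in> fst q \<or>
        set x \<subseteq> commuting r \<and> (x, X \<inter> commuting r) \<in> fst q \<or>
        x \<noteq> [] \<and> last x = r \<and> (butlast x, X \<inter> commuting r) \<in> fst q)},
     insert r (snd q \<inter> commuting r))"

definition accepting :: "'a state \<Rightarrow> bool" where
  "accepting q \<longleftrightarrow> (\<forall>x\<in>bad_words. (x, S) \<notin> fst q)"

lemma finite_states: "finite states"
  by (simp add: states_def finite_bad_prefixes finite_S)

lemma state_in_states: "state w \<in> states"
  by (auto simp: state_def states_def descents_def)

lemma mem_fst_state:
  "(x, X) \<in> fst (state w) \<longleftrightarrow> x \<in> bad_prefixes \<and> X \<subseteq> S \<and> occurs w x X"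
  by (simp add: state_def)

lemma snd_state [simp]: "snd (state w) = descents w"
  by (simp add: state_def)

lemma state_snoc:
  assumes "r \<in> S"
  shows "state (w @ [r]) = transition (state w) r"
proof (rule prod_eqI)
  show "snd (state (w @ [r])) = snd (transition (state w) r)"
    by (simp add: transition_def descents_snoc[OF assms])
  have "(x, X) \<in> fst (state (w @ [r])) \<longleftrightarrow> (x, X) \<in> fst (transition (state w) r)" for x X
  proof (cases "x \<in> bad_prefixes \<and> X \<subseteq> S")
    case True
    then have "butlast x \<in> bad_prefixes" "X \<inter> commuting r \<subseteq> S"
      "successively (\<lambda>s t. m s t \<noteq> 2) x"
      by (auto simp: butlast_bad_prefixes successively_bad_prefixes)
    with True show ?thesis
      by (simp add: transition_def mem_fst_state occurs_snoc[OF assms])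
  qed (auto simp: transition_def mem_fst_state)
  then show "fst (state (w @ [r])) = fst (transition (state w) r)" by auto
qed

lemma state_cong: "comm_eq S m w w' \<Longrightarrow> state w = state w'"
  by (simp add: state_def occurs_cong[of w w'] descents_cong[of w w'])

text \<open>For \<open>X = S\<close> the restriction on the letters after the factor is void, since
  commutations keep a word over \<open>S\<close>.\<close>

lemma good_iff_accepting: "good w \<longleftrightarrow> w \<in> lists S \<and> accepting (state w)"
proof (cases "w \<in> lists S")
  case True
  then have "set v \<subseteq> S" if "comm_eq S m w (u @ x @ v)" for u x v
    using comm_eq_lists[OF that] by auto
  then have "occurs w x S \<longleftrightarrow> (\<exists>u v. comm_eq S m w (u @ x @ v))" for x
    unfolding occurs_def by blast
  then have "accepting (state w) \<longleftrightarrow> (\<forall>x\<in>bad_words. \<nexists>u v. comm_eq S m w (u @ x @ v))"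
    using bad_words_subset_bad_prefixes unfolding accepting_def mem_fst_state by blast
  with True show ?thesis unfolding good_def by blast
qed (simp add: good_def)

lemma good_append: "good (u @ v) \<Longrightarrow> good u"
  unfolding good_def using comm_eq_append by fastforce

subsection \<open>Counting commutation classes\<close>

definition comm_class :: "'a list \<Rightarrow> 'a list set" where
  "comm_class w = {v. comm_eq S m w v}"

lemma comm_class_eq_iff: "comm_class w = comm_class w' \<longleftrightarrow> comm_eq S m w w'"
  unfolding comm_class_def using comm_eq_trans comm_eq_sym comm_eq_refl by blast

definition good_words :: "nat \<Rightarrow> 'a state \<Rightarrow> 'a list set" where
  "good_words l q = {w. good w \<and> length w = l \<and> state w = q}"

lemma finite_good: "finite {w. good w \<and> length w = l}"
  by (rule finite_subset[OF _ finite_lists_length_eq[OF finite_S, of l]]) (auto simp: good_def)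

lemma finite_good_words: "finite (good_words l q)"
  by (rule finite_subset[OF _ finite_good[of l]]) (auto simp: good_words_def)

text \<open>Every nonempty class is written as \<open>w @ [r]\<close> for one chosen \<open>r\<close> among its possible last
  letters, which are read off its state; by cancellation the class of \<open>w\<close> is then unique.\<close>

definition letters_between :: "'a state \<Rightarrow> 'a state \<Rightarrow> 'a set" where
  "letters_between q q' =
     {r \<in> S. transition q r = q' \<and> accepting q' \<and> (SOME t. t \<in> snd q') = r}"

lemma comm_class_good_words_Suc:
  "comm_class ` good_words (Suc l) q' =
     (\<Union>(q, r)\<in>Sigma states (\<lambda>q. letters_between q q'). (\<lambda>w. comm_class (w @ [r])) ` good_words l q)"
  (is "?L = ?R")
proof (intro equalityI subsetI)
  fix c
  assume "c \<in> ?L"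
  then obtain w where w: "good w" "length w = Suc l" "state w = q'" "c = comm_class w"
    by (auto simp: good_words_def)
  define r where "r = (SOME t. t \<in> snd q')"
  have "snd q' = descents w" using w(3) by (auto simp: state_def)
  moreover have "w \<in> lists S" "w \<noteq> []" using w(1,2) by (auto simp: good_def)
  ultimately have "r \<in> descents w"
    unfolding r_def using descents_nonempty some_in_eq by metis
  then obtain u where r: "r \<in> S" and u: "comm_eq S m w (u @ [r])"
    by (auto simp: descents_def)
  have good: "good (u @ [r])" by (rule comm_eq_good[OF u w(1)])
  have st: "transition (state u) r = q'"
    using state_cong[OF u] w(3) by (simp add: state_snoc[OF r])
  have "u \<in> good_words l (state u)"
    using good_append[OF good] comm_eq_length[OF u] w(2) by (simp add: good_words_def)
  moreover have "c = comm_class (u @ [r])"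
    using w(4) u by (simp add: comm_class_eq_iff)
  moreover have "(state u, r) \<in> Sigma states (\<lambda>q. letters_between q q')"
    using st r w(1,3) state_in_states by (simp add: letters_between_def good_iff_accepting r_def)
  ultimately show "c \<in> ?R" by blast
next
  fix c
  assume "c \<in> ?R"
  then obtain q r w where *: "r \<in> letters_between q q'" "w \<in> good_words l q"
    "c = comm_class (w @ [r])" by blast
  then have r: "r \<in> S" "transition q r = q'" "accepting q'"
    by (auto simp: letters_between_def)
  have "state (w @ [r]) = q'"
    using * r by (simp add: good_words_def state_snoc)
  moreover from this have "good (w @ [r])"
    using * r by (simp add: good_words_def good_iff_accepting)
  ultimately have "w @ [r] \<in> good_words (Suc l) q'"
    using * by (simp add: good_words_def)
  with * show "c \<in> ?L" by blast
qed

lemma card_comm_class_good_words_Suc: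
  "card (comm_class ` good_words (Suc l) q') =
     (\<Sum>q\<in>states. card (letters_between q q') * card (comm_class ` good_words l q))"
proof -
  let ?I = "Sigma states (\<lambda>q. letters_between q q')"
  let ?F = "\<lambda>(q, r). (\<lambda>w. comm_class (w @ [r])) ` good_words l q"
  have fin: "finite (letters_between q q')" for q
    using finite_S by (simp add: letters_between_def)
  have "card (comm_class ` good_words (Suc l) q') = card (\<Union>i\<in>?I. ?F i)"
    by (simp only: comm_class_good_words_Suc)
  also have "\<dots> = (\<Sum>i\<in>?I. card (?F i))"
  proof (rule card_UN_disjoint)
    show "finite ?I" using finite_states fin by auto
    show "\<forall>i\<in>?I. finite (?F i)" using finite_good_words by auto
    \<comment> \<open>The chosen last letter is determined by \<open>q'\<close>, so it is the same
      on both sides; cancelling it leaves equivalent words, which have equal states.\<close>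
    show "\<forall>i\<in>?I. \<forall>j\<in>?I. i \<noteq> j \<longrightarrow> ?F i \<inter> ?F j = {}"
    proof (intro ballI impI equals0I)
      fix i j c
      assume ij: "i \<in> ?I" "j \<in> ?I" "i \<noteq> j" and c: "c \<in> ?F i \<inter> ?F j"
      obtain q r p t where [simp]: "i = (q, r)" "j = (p, t)" by (cases i; cases j)
      obtain w v where w: "w \<in> good_words l q" "v \<in> good_words l p"
        "comm_class (w @ [r]) = comm_class (v @ [t])"
        using c by auto
      have "r = t" "r \<in> S" using ij(1,2) by (auto simp: letters_between_def)
      with w(3) have "comm_eq S m w v" by (simp add: comm_class_eq_iff comm_eq_snoc_cancel)
      then have "q = p" using w(1,2) state_cong by (auto simp: good_words_def)
      with \<open>r = t\<close> ij(3) show False by simp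
    qed
  qed
  also have "\<dots> = (\<Sum>(q, r)\<in>?I. card (comm_class ` good_words l q))"
  \<comment> \<open>By cancellation, appending a fixed \<open>r\<close> neither merges nor splits
    commutation classes.\<close>
  proof (intro sum.cong refl)
    fix i
    assume i: "i \<in> ?I"
    obtain q r where [simp]: "i = (q, r)" by (cases i)
    have "r \<in> S" using i by (auto simp: letters_between_def)
    then show "card (?F i) = (case i of (q, r) \<Rightarrow> card (comm_class ` good_words l q))"
      by (simp, intro card_image_eq_card_image) (simp add: comm_class_eq_iff comm_eq_snoc_cancel)
  qed
  also have "\<dots> = (\<Sum>q\<in>states. \<Sum>r\<in>letters_between q q'. card (comm_class ` good_words l q))"
    using finite_states fin by (subst sum.Sigma) auto
  finally show ?thesis by simp
qed

text \<open>Two good words represent the same element exactly when they are commutation equivalent,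
  and the state is constant on classes, so the classes are partitioned by state.\<close>

lemma card_FC_elems:
  "card (FC_elems S m l) = (\<Sum>q\<in>states. card (comm_class ` good_words l q))"
proof -
  let ?G = "{w. good w \<and> length w = l}"
  have "card (FC_elems S m l) = card (comm_class ` ?G)"
    unfolding FC_elems_eq_image
    by (rule card_image_eq_card_image) (simp add: good_cox_elem_eq_iff comm_class_eq_iff)
  also have "?G = (\<Union>q\<in>states. good_words l q)"
    using state_in_states by (auto simp: good_words_def)
  also have "card (comm_class ` \<dots>) = (\<Sum>q\<in>states. card (comm_class ` good_words l q))"
    unfolding image_UN
  proof (rule card_UN_disjoint)
    show "finite states" by (rule finite_states)
    show "\<forall>q\<in>states. finite (comm_class ` good_words l q)" using finite_good_words by auto
    show "\<forall>q\<in>states. \<forall>p\<in>states. q \<noteq> p \<longrightarrow>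
        comm_class ` good_words l q \<inter> comm_class ` good_words l p = {}"
      using state_cong by (auto simp: good_words_def comm_class_eq_iff)
  qed
  finally show ?thesis .
qed

lemma rational_fps_FC_elems:
  "rational_fps (Abs_fps (\<lambda>l. of_nat (card (FC_elems S m l)) :: 'b::field))"
proof -
  have "rational_fps (Abs_fps (\<lambda>l. \<Sum>q\<in>states. of_nat (card (comm_class ` good_words l q)) :: 'b))"
    by (rule rational_fps_transfer_matrix[OF finite_states,
          where M = "\<lambda>q' q. of_nat (card (letters_between q q'))"])
       (simp add: card_comm_class_good_words_Suc)
  then show ?thesis by (simp add: card_FC_elems)
qed

end

theorem theorem1p1:
  fixes S :: "'a set" and m :: "'a \<Rightarrow> 'a \<Rightarrow> enat"
  assumes "coxeter_matrix S m"
  shows "\<exists>p q :: rat poly. coeff q 0 \<noteq> 0 \<and>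
           Abs_fps (\<lambda>l. of_nat (card (FC_elems S m l))) * fps_of_poly q = fps_of_poly p"
proof -
  interpret coxeter_system S m by (rule coxeter_system.intro[OF assms])
  show ?thesis using rational_fps_FC_elems unfolding rational_fps_def by blast
qed

end
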